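(* Let $r \geq 6$ and let $G$ be a graph on $n \geq r$ vertices. If $G$ equipped with a rainbow edge-coloring (all edges receiving distinct colors) is $C_r$-rainbow saturated, then $e(G) \geq \frac{4}{3}n$.
   Context: All graphs are finite, simple and undirected. An edge-coloring of a graph $G$ is a function $\mathcal{C}:E(G)\to\mathbb{N}$; a (sub)graph is rainbow if all its edges have distinct colors. An edge-colored graph $G$ is $C_r$-rainbow saturated if it contains no rainbow copy of the cycle $C_r$ on $r$ vertices but adding any nonedge of $G$ with any color on it creates a rainbow copy of $C_r$. *)

theory Defs
  imports Complex_Main
begin

definition simple_graph :: "'a set \<Rightarrow> 'a set set \<Rightarrow> bool" where
  "simple_graph V E \<longleftrightarrow> finite V \<and> E \<subseteq> {e. e \<subseteq> V \<and> card e = 2}"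

(* Edge-colorings are total functions on vertex sets; only their values on edges matter. *)
definition rainbow :: "('a set \<Rightarrow> nat) \<Rightarrow> 'a set set \<Rightarrow> bool" where
  "rainbow c F \<longleftrightarrow> inj_on c F"

(* Edge set of C_r on the vertex set {0, ..., r - 1}; a cycle graph only for r >= 3. *)
definition cycle_edges :: "nat \<Rightarrow> nat set set" where
  "cycle_edges r = {{i, (i + 1) mod r} | i. i < r}"

(* F is the edge set of a (not necessarily induced) subgraph isomorphic to C_r,
   f being the embedding of C_r. *)
definition cycle_copy :: "nat \<Rightarrow> 'a set \<Rightarrow> 'a set set \<Rightarrow> 'a set set \<Rightarrow> bool" where
  "cycle_copy r V E F \<longleftrightarrow>
     (\<exists>f. inj_on f {..<r} \<and> f ` {..<r} \<subseteq> V \<and> F = (\<lambda>e. f ` e) ` cycle_edges r) \<and> F \<subseteq> E"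

definition has_rainbow_cycle ::
    "nat \<Rightarrow> 'a set \<Rightarrow> 'a set set \<Rightarrow> ('a set \<Rightarrow> nat) \<Rightarrow> bool" where
  "has_rainbow_cycle r V E c \<longleftrightarrow> (\<exists>F. cycle_copy r V E F \<and> rainbow c F)"

(* The color k of the added edge is arbitrary: it may or may not already occur on E. *)
definition cycle_rainbow_saturated ::
    "nat \<Rightarrow> 'a set \<Rightarrow> 'a set set \<Rightarrow> ('a set \<Rightarrow> nat) \<Rightarrow> bool" where
  "cycle_rainbow_saturated r V E c \<longleftrightarrow>
     \<not> has_rainbow_cycle r V E c \<and>
     (\<forall>u\<in>V. \<forall>v\<in>V. u \<noteq> v \<and> {u, v} \<notin> E \<longrightarrow>
        (\<forall>k. has_rainbow_cycle r V (insert {u, v} E) (c({u, v} := k))))"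

end

theory Submission
  imports Defs
begin

text \<open>Recolouring the missing edge \<open>uv\<close> with the colour of \<open>e\<close> shows that nonadjacent \<open>u, v\<close> are
  joined, for every edge \<open>e\<close>, by a path with \<open>r\<close> vertices that avoids \<open>e\<close>. Since there is no
  \<open>C\<^sub>r\<close>, this forces minimum degree \<open>2\<close>; two adjacent vertices of degree \<open>2\<close> form a triangle
  with a vertex of degree at least \<open>4\<close>; two nonadjacent vertices of degree \<open>2\<close> with a common
  neighbour have the same neighbourhood; and a vertex of degree \<open>3\<close> has at most one neighbour of
  degree \<open>2\<close>. Hence the charges \<open>deg v - 8/3\<close> can be redistributed, each vertex of degree \<open>2\<close>
  receiving \<open>2/3\<close> in total from its neighbours, so that none stays negative.\<close>

section \<open>Paths forced by saturation\<close>

definition path_avoiding :: "nat \<Rightarrow> 'a set set \<Rightarrow> 'a set \<Rightarrow> 'a \<Rightarrow> 'a \<Rightarrow> (nat \<Rightarrow> 'a) \<Rightarrow> bool" where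
  "path_avoiding r E e u v p \<longleftrightarrow> p 0 = u \<and> p (r - 1) = v \<and> inj_on p {..<r} \<and>
     (\<forall>i. Suc i < r \<longrightarrow> {p i, p (Suc i)} \<in> E \<and> {p i, p (Suc i)} \<noteq> e)"

lemma path_avoiding_rev:
  assumes "path_avoiding r E e u v p" "r > 0"
  shows "path_avoiding r E e v u (\<lambda>i. p (r - 1 - i))"
  unfolding path_avoiding_def
proof (intro conjI allI impI)
  show "inj_on (\<lambda>i. p (r - 1 - i)) {..<r}"
    using assms unfolding path_avoiding_def inj_on_def by (auto, force)
next
  fix i assume "Suc i < r"
  then have "Suc (r - 1 - Suc i) < r" "Suc (r - 1 - Suc i) = r - 1 - i" by auto
  then show "{p (r - 1 - i), p (r - 1 - Suc i)} \<in> E" "{p (r - 1 - i), p (r - 1 - Suc i)} \<noteq> e"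
    using assms unfolding path_avoiding_def by (metis insert_commute)+
qed (use assms in \<open>auto simp: path_avoiding_def\<close>)

text \<open>Cutting the cycle between positions \<open>i\<close> and \<open>(i + 1) mod r\<close>
  and reading on from the latter gives a path from \<open>u\<close> to \<open>v\<close> through all
  \<open>r\<close> vertices.\<close>

lemma cycle_edges_image_rotate:
  fixes f :: "nat \<Rightarrow> 'a"
  assumes "inj_on f {..<r}" "(\<lambda>e. f ` e) ` cycle_edges r \<subseteq> insert {u, v} E"
    "e \<notin> (\<lambda>e. f ` e) ` cycle_edges r" "r \<ge> 3"
    "i < r" "f i = v" "f ((i + 1) mod r) = u"
  shows "\<exists>p. path_avoiding r E e u v p"
proof -
  define g where "g j = f ((i + 1 + j) mod r)" for j
  have inj: "inj_on g {..<r}"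
  proof (rule inj_onI)
    fix x y assume xy: "x \<in> {..<r}" "y \<in> {..<r}" "g x = g y"
    then have "(i + 1 + x) mod r = (i + 1 + y) mod r"
      using inj_onD[OF assms(1), of "(i + 1 + x) mod r" "(i + 1 + y) mod r"] assms(4)
      unfolding g_def by simp
    then have "int ((i + 1 + x) mod r) = int ((i + 1 + y) mod r)" by simp
    then have "int r dvd int x - int y"
      by (simp add: zmod_int mod_eq_dvd_iff)
    moreover have "\<bar>int x - int y\<bar> < int r" using xy by auto
    ultimately show "x = y"
      by (metis dvd_imp_le_int eq_iff_diff_eq_0 abs_of_nat not_le of_nat_eq_iff)
  qed
  have g0: "g 0 = u" and g1: "g (r - 1) = v"
    using assms unfolding g_def by auto
  have "{g j, g (Suc j)} \<in> E \<and> {g j, g (Suc j)} \<noteq> e" if "Suc j < r" for j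
  proof -
    have "{g j, g (Suc j)} = f ` {(i + 1 + j) mod r, ((i + 1 + j) mod r + 1) mod r}"
      unfolding g_def by (simp add: mod_simps)
    moreover have "{(i + 1 + j) mod r, ((i + 1 + j) mod r + 1) mod r} \<in> cycle_edges r"
      unfolding cycle_edges_def by (rule CollectI, intro exI conjI, rule refl) (use assms(4) in simp)
    ultimately have "{g j, g (Suc j)} \<in> (\<lambda>e. f ` e) ` cycle_edges r" by (rule image_eqI)
    \<comment> \<open>\<open>u\<close> and \<open>v\<close> sit at positions \<open>0\<close> and
      \<open>r - 1\<close>, which are consecutive only for \<open>r = 2\<close>.\<close>
    moreover have "{g j, g (Suc j)} \<noteq> {u, v}"
    proof
      assume "{g j, g (Suc j)} = {u, v}"
      then have "g j = g 0 \<and> g (Suc j) = g (r - 1) \<or> g (Suc j) = g 0"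
        unfolding g0 g1 by (auto simp: doubleton_eq_iff)
      moreover have "g x = g y \<longleftrightarrow> x = y" if "x < r" "y < r" for x y
        using inj_on_eq_iff[OF inj] that by simp
      ultimately have "j = 0 \<and> Suc j = r - 1 \<or> Suc j = 0"
        using that assms(4) by simp
      then show False using assms(4) by linarith
    qed
    ultimately show ?thesis using assms(2,3) by auto
  qed
  then show ?thesis using inj g0 g1 unfolding path_avoiding_def by blast
qed

lemma rainbow_saturated_path:
  assumes "cycle_rainbow_saturated r V E c" "rainbow c E" "r \<ge> 3"
    "u \<in> V" "v \<in> V" "u \<noteq> v" "{u, v} \<notin> E" "e \<noteq> {u, v}"
  shows "\<exists>p. path_avoiding r E e u v p"
proof -
  have "has_rainbow_cycle r V (insert {u, v} E) (c({u, v} := c e))"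
    using assms unfolding cycle_rainbow_saturated_def by blast
  then obtain F where F: "cycle_copy r V (insert {u, v} E) F"
    and rb: "rainbow (c({u, v} := c e)) F"
    unfolding has_rainbow_cycle_def by (elim exE conjE)
  from F obtain f where f: "inj_on f {..<r}" "f ` {..<r} \<subseteq> V"
    and F_eq: "F = (\<lambda>e. f ` e) ` cycle_edges r"
    unfolding cycle_copy_def by (elim exE conjE)
  let ?F = "(\<lambda>e. f ` e) ` cycle_edges r"
  have sub: "?F \<subseteq> insert {u, v} E" and rb: "inj_on (c({u, v} := c e)) ?F"
    using F rb unfolding F_eq by (simp_all add: cycle_copy_def rainbow_def)
  \<comment> \<open>A copy without \<open>{u, v}\<close> would lie in \<open>E\<close> and be
    rainbow under \<open>c\<close> already.\<close>
  have uvF: "{u, v} \<in> ?F"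
  proof (rule ccontr)
    assume "{u, v} \<notin> ?F"
    then have "?F \<subseteq> E" using sub by blast
    then have "cycle_copy r V E F" "rainbow c F"
      using f assms(2) F_eq inj_on_subset[of c E] unfolding cycle_copy_def rainbow_def by metis+
    then have "has_rainbow_cycle r V E c" unfolding has_rainbow_cycle_def by blast
    then show False using assms(1) unfolding cycle_rainbow_saturated_def by blast
  qed
  \<comment> \<open>Under the modified coloring \<open>e\<close> and \<open>{u, v}\<close> share a
    color, so a rainbow cycle through one misses the other.\<close>
  have eF: "e \<notin> ?F"
    using inj_onD[OF rb, of e "{u, v}"] uvF assms(8) by auto
  obtain i where i: "i < r" "{u, v} = {f i, f ((i + 1) mod r)}"
    using uvF unfolding cycle_edges_def by auto
  from i(2) consider "f i = v" "f ((i + 1) mod r) = u" | "f i = u" "f ((i + 1) mod r) = v"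
    by (auto simp: doubleton_eq_iff)
  then show ?thesis
  proof cases
    case 1
    then show ?thesis using cycle_edges_image_rotate[OF f(1) sub eF assms(3) i(1)] by blast
  next
    case 2
    \<comment> \<open>The cycle traverses the new edge in the other direction, so the path found
      runs from \<open>v\<close> to \<open>u\<close> and has to be reversed.\<close>
    have "?F \<subseteq> insert {v, u} E" using sub by (simp add: insert_commute)
    from cycle_edges_image_rotate[OF f(1) this eF assms(3) i(1) 2]
    show ?thesis using path_avoiding_rev assms(3) by fastforce
  qed
qed

text \<open>As \<open>c\<close> is injective on \<open>E\<close>, every \<open>r\<close>-cycle of
  the graph is rainbow.\<close>

lemma rainbow_saturated_no_cycle:
  assumes "cycle_rainbow_saturated r V E c" "rainbow c E" "simple_graph V E" "r > 0"
    "inj_on p {..<r}" "\<And>i. Suc i < r \<Longrightarrow> {p i, p (Suc i)} \<in> E" "{p (r - 1), p 0} \<in> E"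
  shows False
proof -
  have edge: "{p i, p ((i + 1) mod r)} \<in> E" if "i < r" for i
  proof (cases "Suc i < r")
    case True
    then show ?thesis using assms(6) by simp
  next
    case False
    then have "i = r - 1" using that by auto
    then show ?thesis using assms(4,7) by simp
  qed
  then have sub: "(\<lambda>e. p ` e) ` cycle_edges r \<subseteq> E"
    unfolding cycle_edges_def by auto
  have "p ` {..<r} \<subseteq> V"
    using edge assms(3) unfolding simple_graph_def by fastforce
  then have "cycle_copy r V E ((\<lambda>e. p ` e) ` cycle_edges r)"
    unfolding cycle_copy_def using sub assms(5) by blast
  moreover have "rainbow c ((\<lambda>e. p ` e) ` cycle_edges r)"
    using sub assms(2) inj_on_subset[of c E] unfolding rainbow_def by blast
  ultimately have "has_rainbow_cycle r V E c" unfolding has_rainbow_cycle_def by blast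
  then show False using assms(1) unfolding cycle_rainbow_saturated_def by blast
qed

section \<open>The color-free setting\<close>

locale edge_robust_saturated =
  fixes V :: "'a set" and E :: "'a set set" and r :: nat
  assumes r6: "r \<ge> 6"
    and simple: "simple_graph V E"
    and order: "card V \<ge> r"
    and no_cycle: "\<And>p. inj_on p {..<r} \<Longrightarrow> (\<And>i. Suc i < r \<Longrightarrow> {p i, p (Suc i)} \<in> E) \<Longrightarrow>
      {p (r - 1), p 0} \<in> E \<Longrightarrow> False"
    and path: "\<And>u v e. u \<in> V \<Longrightarrow> v \<in> V \<Longrightarrow> u \<noteq> v \<Longrightarrow> {u, v} \<notin> E \<Longrightarrow> e \<noteq> {u, v} \<Longrightarrow>
      \<exists>p. path_avoiding r E e u v p"
begin

definition N :: "'a \<Rightarrow> 'a set" where "N v = {w. {v, w} \<in> E}"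

lemma finV: "finite V"
  using simple by (simp add: simple_graph_def)

lemma finE: "finite E"
  using simple unfolding simple_graph_def by (auto intro: finite_subset[of E "Pow V"])

lemma ne2: "2 \<noteq> r - 1"
  using r6 by linarith

lemma N_sym: "w \<in> N v \<longleftrightarrow> v \<in> N w"
  by (simp add: N_def insert_commute)

lemma N_irrefl: "v \<notin> N v"
  using simple unfolding simple_graph_def N_def by auto

lemma N_V: "w \<in> N v \<Longrightarrow> w \<in> V \<and> v \<in> V"
  using simple unfolding simple_graph_def N_def by auto

lemma finN: "finite (N v)"
  using finV N_V by (meson finite_subset subsetI)

lemma N_path:
  assumes "u \<in> V" "v \<in> V" "u \<noteq> v" "v \<notin> N u" "{a, b} \<noteq> {u, v}"
  obtains p where "p 0 = u" "p (r - 1) = v" "inj_on p {..<r}"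
    "\<forall>i. Suc i < r \<longrightarrow> p (Suc i) \<in> N (p i)"
    "\<forall>i. Suc i < r \<longrightarrow> {p i, p (Suc i)} \<noteq> {a, b}"
  using path[of u v "{a, b}"] assms unfolding path_avoiding_def N_def by auto

text \<open>The handshake lemma, by counting incident pairs of a vertex and an edge in two
  ways.\<close>

lemma sum_card_N: "(\<Sum>v\<in>V. card (N v)) = 2 * card E"
proof -
  have "card (N v) = card {e \<in> E. v \<in> e}" for v
  proof (rule bij_betw_same_card)
    show "bij_betw (\<lambda>w. {v, w}) (N v) {e \<in> E. v \<in> e}"
    proof (rule bij_betw_imageI)
      show "inj_on (\<lambda>w. {v, w}) (N v)" by (auto simp: inj_on_def doubleton_eq_iff)
      show "(\<lambda>w. {v, w}) ` N v = {e \<in> E. v \<in> e}"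
      proof (intro subset_antisym subsetI)
        fix e assume e: "e \<in> {e \<in> E. v \<in> e}"
        then have "card e = 2" using simple unfolding simple_graph_def by auto
        then obtain x y where "e = {x, y}" by (meson card_2_iff)
        then show "e \<in> (\<lambda>w. {v, w}) ` N v" using e unfolding N_def
          by (auto simp: insert_commute)
      qed (auto simp: N_def)
    qed
  qed
  then have "(\<Sum>v\<in>V. card (N v)) = (\<Sum>v\<in>V. \<Sum>e\<in>E. if v \<in> e then 1 else 0)"
    using finE by (simp add: sum.If_cases Int_def)
  also have "\<dots> = (\<Sum>e\<in>E. \<Sum>v\<in>V. if v \<in> e then 1 else 0)" by (rule sum.swap)
  also have "\<dots> = (\<Sum>e\<in>E. 2)"
  proof (rule sum.cong[OF refl])
    fix e assume "e \<in> E"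
    then have "e \<subseteq> V" "card e = 2" using simple unfolding simple_graph_def by auto
    then have "V \<inter> {v. v \<in> e} = e" by auto
    then show "(\<Sum>v\<in>V. if v \<in> e then 1 else 0) = (2 :: nat)"
      using finV \<open>card e = 2\<close> by (simp add: sum.If_cases)
  qed
  finally show ?thesis by simp
qed

lemma ex_outside:
  assumes "length xs < 6"
  shows "\<exists>w\<in>V. w \<notin> set xs"
proof (rule ccontr)
  assume "\<not> ?thesis"
  then have "card V \<le> card (set xs)" by (intro card_mono) auto
  then show False using assms card_length[of xs] order r6 by linarith
qed

section \<open>Vertices of degree 2 and 3\<close>

text \<open>If \<open>v\<close> had at most one edge, a path that starts at \<open>v\<close> and
  avoids this edge could not take its first step.\<close>

lemma card_N_ge_2:
  assumes v: "v \<in> V"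
  shows "card (N v) \<ge> 2"
proof (rule ccontr)
  assume "\<not> card (N v) \<ge> 2"
  then have "card (N v) = 0 \<or> card (N v) = 1" by linarith
  then have "\<exists>x. N v \<subseteq> {x}"
    using finN by (auto simp: card_1_singleton_iff)
  then obtain x where x: "N v \<subseteq> {x}" by blast
  obtain w where w: "w \<in> V" "w \<notin> {v, x}"
    using ex_outside[of "[v, x]"] by auto
  have nadj: "w \<notin> N v" using w x by auto
  have ne: "{v, x} \<noteq> {v, w}" "v \<noteq> w" using w by (auto simp: doubleton_eq_iff)
  obtain p where p: "p 0 = v" "p (r - 1) = w" "inj_on p {..<r}"
    "\<forall>i. Suc i < r \<longrightarrow> p (Suc i) \<in> N (p i)"
    "\<forall>i. Suc i < r \<longrightarrow> {p i, p (Suc i)} \<noteq> {v, x}"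
    by (rule N_path[OF v w(1) ne(2) nadj ne(1)])
  have "p (Suc 0) \<in> N v" "{v, p (Suc 0)} \<noteq> {v, x}"
    using p(4)[rule_format, of 0] p(5)[rule_format, of 0] p(1) r6 by auto
  then show False using x by auto
qed

text \<open>If the other neighbours \<open>a\<close> of \<open>u\<close> and \<open>b\<close> of
  \<open>v\<close> differed, a path from \<open>u\<close> to \<open>b\<close> avoiding
  \<open>{u, a}\<close> would have to be \<open>u, v, b\<close>, which is too short. So
  \<open>u, v, a\<close> is a triangle, and were it attached by at most one further edge, forbidding
  that edge would trap every path from \<open>u\<close>.\<close>

lemma adjacent_degree_2:
  assumes u: "card (N u) = 2" and v: "card (N v) = 2" and uv: "v \<in> N u"
  obtains a where "N u = {v, a}" "N v = {u, a}" "card (N a) \<ge> 4"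
proof -
  obtain a where a: "N u = {v, a}" "a \<noteq> v"
    using u uv by (metis card_2_iff insert_commute insertE singletonD)
  have vu: "u \<in> N v" using uv N_sym by blast
  obtain b where b: "N v = {u, b}" "b \<noteq> u"
    using v vu by (metis card_2_iff insert_commute insertE singletonD)
  have ua: "a \<noteq> u" "b \<noteq> v" "u \<noteq> v" using a b N_irrefl vu by auto
  have V: "u \<in> V" "v \<in> V" "a \<in> V" "b \<in> V" using a b N_V by blast+
  have ab: "a = b"
  proof (rule ccontr)
    assume ne: "a \<noteq> b"
    have nb: "b \<notin> N u" using a b ne ua by auto
    have ne': "{u, a} \<noteq> {u, b}" using ne by (auto simp: doubleton_eq_iff)
    obtain p where p: "p 0 = u" "p (r - 1) = b" "inj_on p {..<r}"
      "\<forall>i. Suc i < r \<longrightarrow> p (Suc i) \<in> N (p i)"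
      "\<forall>i. Suc i < r \<longrightarrow> {p i, p (Suc i)} \<noteq> {u, a}"
      by (rule N_path[OF V(1,4) b(2)[symmetric] nb ne'])
    have p1: "p 1 = v" using p(4)[rule_format, of 0] p(5)[rule_format, of 0] p(1) r6 a by auto
    have "p 2 = u \<or> p 2 = b" using p(4)[rule_format, of 1] p1 r6 b by (auto simp: numeral_2_eq_2)
    then show False
      using inj_on_contraD[OF p(3), of 2 0] inj_on_contraD[OF p(3), of 2 "r - 1"] p(1,2) r6 ne2
      by simp
  qed
  have Na: "u \<in> N a" "v \<in> N a" using a b ab N_sym by auto
  have "card (N a) \<ge> 4"
  proof (rule ccontr)
    assume "\<not> card (N a) \<ge> 4"
    then have "card (N a - {u, v}) \<le> 1"
      using Na ua finN by (simp add: card_Diff_subset)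
    then have "card (N a - {u, v}) = 0 \<or> card (N a - {u, v}) = 1" by linarith
    then have "N a - {u, v} = {} \<or> (\<exists>w0. N a - {u, v} = {w0})"
      using finN by (simp add: card_1_singleton_iff del: Diff_eq_empty_iff)
    \<comment> \<open>If \<open>a\<close> has no further neighbour, \<open>w0\<close> is
      arbitrary.\<close>
    then have "\<exists>w0. N a - {u, v} \<subseteq> {w0}" by blast
    then obtain w0 where w0: "N a \<subseteq> {u, v, w0}" by blast
    obtain w where w: "w \<in> V" "w \<notin> {u, v, a, w0}"
      using ex_outside[of "[u, v, a, w0]"] by auto
    have nw: "w \<notin> N u" and uw: "u \<noteq> w" using w a by auto
    have ne: "{a, w0} \<noteq> {u, w}" using w by (auto simp: doubleton_eq_iff)
    obtain p where p: "p 0 = u" "p (r - 1) = w" "inj_on p {..<r}"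
      "\<forall>i. Suc i < r \<longrightarrow> p (Suc i) \<in> N (p i)"
      "\<forall>i. Suc i < r \<longrightarrow> {p i, p (Suc i)} \<noteq> {a, w0}"
      by (rule N_path[OF V(1) w(1) uw nw ne])
    have "p i \<in> {u, v, a}" if "i < r" for i
      using that
    proof (induction i)
      case (Suc i)
      then have "p i \<in> {u, v, a}" by simp
      then show ?case
        using p(4)[rule_format, OF Suc.prems] p(5)[rule_format, OF Suc.prems] a b ab w0 by auto
    qed (use p in auto)
    from this[of "r - 1"] show False using p(2) w r6 by auto
  qed
  then show ?thesis using that a b ab by blast
qed

text \<open>A path with \<open>r\<close> vertices from \<open>u\<close> to \<open>v'\<close> that avoids the edge \<open>{u, u'}\<close> starts with
  \<open>u, a\<close>; replacing \<open>u\<close> by \<open>v\<close>, which it misses, turns it into an \<open>r\<close>-cycle.\<close>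

lemma degree_2_common_neighbour:
  assumes u: "N u = {a, u'}" and v: "N v = {a, v'}" "a \<noteq> v'" and uv: "u \<noteq> v" "v \<notin> N u"
  shows "u' = v'"
proof (rule ccontr)
  assume ne: "u' \<noteq> v'"
  have uN: "u \<notin> N v" using uv N_sym by blast
  have V: "u \<in> V" "v' \<in> V" using u v N_V by blast+
  have nadj: "v' \<notin> N u" "v' \<noteq> u" using u v ne uN by auto
  have ne': "{u, u'} \<noteq> {u, v'}" using ne by (auto simp: doubleton_eq_iff)
  obtain p where p: "p 0 = u" "p (r - 1) = v'" "inj_on p {..<r}"
    "\<forall>i. Suc i < r \<longrightarrow> p (Suc i) \<in> N (p i)"
    "\<forall>i. Suc i < r \<longrightarrow> {p i, p (Suc i)} \<noteq> {u, u'}"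
    by (rule N_path[OF V nadj(2)[symmetric] nadj(1) ne'])
  have p1: "p 1 = a" using p(4)[rule_format, of 0] p(5)[rule_format, of 0] p(1) r6 u by auto
  \<comment> \<open>Both neighbours of \<open>v\<close> lie on the path, at positions
    \<open>1\<close> and \<open>r - 1\<close>. An inner position \<open>i\<close> of
    \<open>v\<close> would need \<open>i - 1 = 1\<close> and \<open>i + 1 = r - 1\<close>, hence
    \<open>r = 4\<close>.\<close>
  have vp: "p i \<noteq> v" if i: "i < r" for i
  proof
    assume piv: "p i = v"
    have "v \<noteq> a" "v \<noteq> v'" using v N_irrefl by blast+
    then have "i \<noteq> 0" "i \<noteq> 1" "i \<noteq> r - 1" using piv p(1,2) p1 uv(1) by metis+
    then have i2: "1 < i" "Suc i < r" using i by auto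
    have "p (Suc i) \<in> N v" using p(4)[rule_format, of i] i2(2) piv by simp
    moreover have "v \<in> N (p (i - 1))"
      using p(4)[rule_format, of "i - 1"] i2 piv by simp
    then have "p (i - 1) \<in> N v" using N_sym by blast
    ultimately have "p (Suc i) = p 1 \<or> p (Suc i) = p (r - 1)"
      "p (i - 1) = p 1 \<or> p (i - 1) = p (r - 1)"
      using v(1) p1 p(2) by blast+
    moreover have "p x = p y \<longleftrightarrow> x = y" if "x < r" "y < r" for x y
      using inj_on_eq_iff[OF p(3)] that by simp
    ultimately have "Suc i = 1 \<or> Suc i = r - 1" "i - 1 = 1 \<or> i - 1 = r - 1"
      using i2 r6 by simp_all
    then show False using r6 i2 by linarith
  qed
  define q where "q = p(0 := v)"
  have "inj_on q {..<r}"
    using p(3) vp unfolding q_def inj_on_def by auto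
  moreover have "{q i, q (Suc i)} \<in> E" if "Suc i < r" for i
    using p(4)[rule_format, OF that] p1 v unfolding q_def N_def by auto
  moreover have "{q (r - 1), q 0} \<in> E"
    using p(2) v r6 N_sym unfolding q_def N_def by (auto simp: insert_commute)
  ultimately show False by (rule no_cycle)
qed

text \<open>Let \<open>w\<close> be the third neighbour of \<open>a\<close>. If \<open>w\<close> is
  not \<open>s\<close>, a path from \<open>a\<close> to \<open>s\<close> avoiding
  \<open>{a, w}\<close> reaches \<open>s\<close> after two steps, too early. If
  \<open>w = s\<close>, a path from \<open>u\<close> to \<open>v\<close> has \<open>a\<close> and
  \<open>s\<close> as its second and second-to-last vertices, and cannot continue from
  \<open>a\<close>.\<close>

lemma degree_3_twins:
  assumes a: "card (N a) = 3" and uv: "u \<in> N a" "v \<in> N a" "u \<noteq> v"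
    and u: "N u = {a, s}" and v: "N v = {a, s}" and s: "a \<noteq> s"
  shows False
proof -
  have "card (N a - {u, v}) = 1" using a uv finN by (simp add: card_Diff_subset)
  then obtain w where "N a - {u, v} = {w}" by (auto simp: card_1_singleton_iff)
  then have w: "N a = {u, v, w}" "w \<noteq> u" "w \<noteq> v" using uv by auto
  have V: "u \<in> V" "v \<in> V" "a \<in> V" "s \<in> V" using u v uv N_V by blast+
  have su: "s \<noteq> u" "s \<noteq> v" using u v N_irrefl by auto
  then have nuv: "v \<notin> N u" using u uv N_irrefl by auto
  show False
  proof (cases "s = w")
    case False
    have na: "s \<notin> N a" using w su False by auto
    have ne: "{a, w} \<noteq> {a, s}" using False by (auto simp: doubleton_eq_iff)
    obtain p where p: "p 0 = a" "p (r - 1) = s" "inj_on p {..<r}"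
      "\<forall>i. Suc i < r \<longrightarrow> p (Suc i) \<in> N (p i)"
      "\<forall>i. Suc i < r \<longrightarrow> {p i, p (Suc i)} \<noteq> {a, w}"
      by (rule N_path[OF V(3,4) s na ne])
    have "p 1 = u \<or> p 1 = v" using p(4)[rule_format, of 0] p(5)[rule_format, of 0] p(1) r6 w by auto
    then have "p 2 = a \<or> p 2 = s" using p(4)[rule_format, of 1] r6 u v by (auto simp: numeral_2_eq_2)
    then show False
      using inj_on_contraD[OF p(3), of 2 0] inj_on_contraD[OF p(3), of 2 "r - 1"] p(1,2) r6 ne2
      by simp
  next
    case True
    \<comment> \<open>Only the existence of a path matters here; \<open>{u, u}\<close> is no edge,
      so avoiding it is no restriction.\<close>
    have ne: "{u, u} \<noteq> {u, v}" using uv(3) by auto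
    obtain p where p: "p 0 = u" "p (r - 1) = v" "inj_on p {..<r}"
      "\<forall>i. Suc i < r \<longrightarrow> p (Suc i) \<in> N (p i)"
      "\<forall>i. Suc i < r \<longrightarrow> {p i, p (Suc i)} \<noteq> {u, u}"
      by (rule N_path[OF V(1,2) uv(3) nuv ne])
    have ne: "p i \<noteq> p j" if "i < r" "j < r" "i \<noteq> j" for i j
      using inj_on_contraD[OF p(3)] that by simp
    have "Suc (r - 2) = r - 1" "Suc (r - 3) = r - 2" using r6 by linarith+
    then have step: "p (r - 1) \<in> N (p (r - 2))" "p (r - 2) \<in> N (p (r - 3))"
      using p(4)[rule_format, of "r - 2"] p(4)[rule_format, of "r - 3"] r6 by simp_all
    then have "v \<in> N (p (r - 2))" using p(2) by simp
    then have "p (r - 2) = a \<or> p (r - 2) = s" using v N_sym by blast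
    moreover have "p 1 = a \<or> p 1 = s" using p(4)[rule_format, of 0] p(1) r6 u by auto
    moreover have "p 1 \<noteq> p (r - 2)" using ne[of 1 "r - 2"] r6 by auto
    ultimately consider "p 1 = a" "p (r - 2) = s" | "p 1 = s" "p (r - 2) = a" by auto
    then show False
    proof cases
      case 1
      \<comment> \<open>The neighbours of \<open>a\<close> already occupy positions
        \<open>0\<close>, \<open>r - 1\<close> and \<open>r - 2\<close>, all different from
        \<open>2\<close>. The other case is the mirror image at position
        \<open>r - 3\<close>.\<close>
      have "p 2 \<in> {u, v, s}" using p(4)[rule_format, of 1] r6 1 w True by (auto simp: numeral_2_eq_2)
      then show False using ne[of 2 0] ne[of 2 "r - 1"] ne[of 2 "r - 2"] p(1,2) 1 r6 ne2 by auto
    next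
      case 2
      have "a \<in> N (p (r - 3))" using step(2) 2 by simp
      then have "p (r - 3) \<in> N a" using N_sym by blast
      then have "p (r - 3) \<in> {u, v, s}" using w True by blast
      then show False
        using ne[of "r - 3" 0] ne[of "r - 3" "r - 1"] ne[of "r - 3" 1] p(1,2) 2 r6 by auto
    qed
  qed
qed

section \<open>Discharging\<close>

text \<open>What \<open>a\<close> hands to \<open>u\<close> in the discharging, in thirds, so that \<open>v\<close> starts with
  \<open>3 deg v - 8\<close>. The value \<open>2\<close> occurs when \<open>u\<close> lies in a triangle hanging at \<open>a\<close>.\<close>

definition charge :: "'a \<Rightarrow> 'a \<Rightarrow> nat" where
  "charge a u =
    (if u \<in> N a \<and> card (N u) = 2 \<and> card (N a) \<ge> 3
     then if \<exists>v\<in>N u. card (N v) = 2 then 2 else 1 else 0)"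

text \<open>Either both neighbours have degree at least 3 and give 1 each, or one has degree 2 and
  gives nothing, while the other then has degree at least 4 and gives 2.\<close>

lemma charge_received:
  assumes "card (N u) = 2"
  shows "(\<Sum>a\<in>V. charge a u) = 2"
proof -
  obtain a b where ab: "N u = {a, b}" "a \<noteq> b" using assms by (meson card_2_iff)
  have sym: "u \<in> N a" "u \<in> N b" using ab N_sym by auto
  have V: "a \<in> V" "b \<in> V" using ab N_V by blast+
  have "(\<Sum>x\<in>V. charge x u) = (\<Sum>x\<in>{a, b}. charge x u)"
  proof (rule sum.mono_neutral_right)
    show "\<forall>x\<in>V - {a, b}. charge x u = 0"
      using ab(1) N_sym[of _ u] unfolding charge_def by auto
  qed (use finV V in auto)
  also have "\<dots> = charge a u + charge b u" using ab by simp
  also have "\<dots> = 2"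
  proof -
    have c: "card (N a) \<ge> 2" "card (N b) \<ge> 2" using V card_N_ge_2 by auto
    show ?thesis
    proof (cases "card (N a) = 2 \<or> card (N b) = 2")
      case False
      then show ?thesis using c ab sym assms unfolding charge_def by auto
    next
      case True
      have *: "card (N y) \<ge> 4" if "card (N x) = 2" "N u = {x, y}" "x \<noteq> y" for x y
        using adjacent_degree_2[OF assms that(1)] that by (metis doubleton_eq_iff insertI1)
      show ?thesis
        using True *[of a b] *[of b a] ab sym assms unfolding charge_def
        by (auto simp: insert_commute)
    qed
  qed
  finally show ?thesis .
qed

text \<open>If two degree-2 neighbours of \<open>a\<close> are adjacent, they are the only ones;
  they take at most 4, and \<open>a\<close> has degree at least 4. Otherwise each takes at most 1:
  degree 3 allows one recipient, and for \<open>d \<ge> 4\<close> one has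
  \<open>d \<le> 3 * d - 8\<close>.\<close>

lemma charge_sent:
  assumes deg: "card (N a) \<ge> 3"
  shows "(\<Sum>u\<in>V. charge a u) + 8 \<le> 3 * card (N a)"
proof -
  define S where "S = {u \<in> N a. card (N u) = 2}"
  have S: "S \<subseteq> N a" "finite S" unfolding S_def using finN by auto
  have SV: "S \<subseteq> V" using S N_V by blast
  have sumS: "(\<Sum>u\<in>V. charge a u) = (\<Sum>u\<in>S. charge a u)"
    by (rule sum.mono_neutral_right) (use finV SV in \<open>auto simp: charge_def S_def\<close>)
  have other: "\<exists>x. N u = {a, x} \<and> a \<noteq> x" if "u \<in> S" for u
  proof -
    have "a \<in> N u" using that S N_sym by blast
    moreover have "card (N u) = 2" using that unfolding S_def by simp
    ultimately show ?thesis by (metis card_2_iff insert_commute insertE singletonD)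
  qed
  show ?thesis
  proof (cases "\<exists>u\<in>S. \<exists>v\<in>S. v \<in> N u")
    case True
    then obtain u v where uv: "u \<in> S" "v \<in> S" "v \<in> N u" by blast
    then have cards: "card (N u) = 2" "card (N v) = 2" unfolding S_def by auto
    obtain b where b: "N u = {v, b}" "N v = {u, b}" "card (N b) \<ge> 4"
      by (rule adjacent_degree_2[OF cards uv(3)])
    have a: "a \<in> N u" "a \<in> N v" using uv(1,2) S(1) N_sym by blast+
    then have "a \<noteq> v" using N_irrefl by blast
    then have ba: "b = a" using a(1) b(1) by simp
    \<comment> \<open>Comparing a further \<open>x\<close> in \<open>S\<close> with \<open>u\<close>
      and with \<open>v\<close> would make its second neighbour equal to both \<open>v\<close> and
      \<open>u\<close>.\<close>
    have "S \<subseteq> {u, v}"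
    proof
      fix x assume x: "x \<in> S"
      obtain y where y: "N x = {a, y}" "a \<noteq> y" using other x by blast
      show "x \<in> {u, v}"
      proof (rule ccontr)
        assume nx: "x \<notin> {u, v}"
        have xa: "x \<noteq> a" using y N_irrefl by blast
        have "x \<notin> N u" "x \<notin> N v" using nx xa b ba by auto
        moreover have "N u = {a, v}" "N v = {a, u}" using b ba by auto
        ultimately have "v = y" "u = y"
          using degree_2_common_neighbour[OF _ y] nx by blast+
        then show False using uv(3) N_irrefl by blast
      qed
    qed
    then have "(\<Sum>u\<in>S. charge a u) \<le> (\<Sum>u\<in>{u, v}. charge a u)"
      by (intro sum_mono2) auto
    also have "\<dots> \<le> (\<Sum>u\<in>{u, v}. 2)"
      by (rule sum_mono) (simp add: charge_def)
    also have "\<dots> \<le> 4" by (simp add: card_insert_if)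
    finally show ?thesis using sumS b(3) unfolding ba by linarith
  next
    case False
    have "charge a u \<le> 1" if u: "u \<in> S" for u
    proof -
      \<comment> \<open>A degree-2 neighbour \<open>v\<close> of \<open>u\<close> would close a
        triangle with \<open>a\<close>, putting two adjacent vertices into \<open>S\<close>.\<close>
      have "card (N v) \<noteq> 2" if v: "v \<in> N u" for v
      proof
        assume c: "card (N v) = 2"
        have "card (N u) = 2" using u unfolding S_def by auto
        then obtain b where b: "N u = {v, b}" "N v = {u, b}" "card (N b) \<ge> 4"
          using c v by (rule adjacent_degree_2)
        have "v \<noteq> a" using c deg by auto
        moreover have "u \<in> N a" using u S(1) by (rule subsetD[rotated])
        then have "a \<in> N u" by (simp only: N_sym[of a])
        ultimately have "a \<in> N v" using b by simp
        then have "v \<in> N a" by (simp only: N_sym[of a])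
        then have "v \<in> S" using c by (simp add: S_def)
        then show False using False u v by blast
      qed
      then show ?thesis by (simp add: charge_def)
    qed
    then have "(\<Sum>u\<in>S. charge a u) \<le> (\<Sum>u\<in>S. 1)" by (rule sum_mono)
    then have le: "(\<Sum>u\<in>V. charge a u) \<le> card S" using sumS by simp
    have cS: "card S \<le> card (N a)" using S finN by (simp add: card_mono)
    show ?thesis
    proof (cases "card (N a) = 3")
      case True
      \<comment> \<open>Two members of \<open>S\<close> are nonadjacent in this case, hence twins,
        which degree 3 rules out.\<close>
      have "card S \<le> Suc 0"
      proof (rule ccontr)
        assume "\<not> card S \<le> Suc 0"
        then obtain u v where uv: "u \<in> S" "v \<in> S" "u \<noteq> v"
          using S(2) by (auto simp: card_le_Suc0_iff_eq)
        obtain x where x: "N u = {a, x}" "a \<noteq> x" using other[OF uv(1)] by blast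
        obtain y where y: "N v = {a, y}" "a \<noteq> y" using other[OF uv(2)] by blast
        have "v \<notin> N u" using False uv(1,2) by blast
        then have "x = y" by (rule degree_2_common_neighbour[OF x(1) y uv(3)])
        moreover have "u \<in> N a" "v \<in> N a" using uv(1,2) S(1) by (simp_all add: subset_iff)
        ultimately show False using degree_3_twins[OF True _ _ uv(3) _ _ y(2)] x(1) y(1) by simp
      qed
      then show ?thesis using le True by linarith
    next
      case False
      then show ?thesis using le cS deg False by linarith
    qed
  qed
qed

lemma edge_bound: "4 * card V \<le> 3 * card E"
proof -
  define D where "D = {v \<in> V. card (N v) = 2}"
  have D: "D \<subseteq> V" "finite D" unfolding D_def using finV by auto
  \<comment> \<open>Only vertices in \<open>D\<close> receive and only vertices outside
    \<open>D\<close> send, so the total of 2 per vertex of \<open>D\<close> is paid by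
    \<open>V - D\<close>.\<close>
  have "2 * card D = (\<Sum>u\<in>D. \<Sum>a\<in>V. charge a u)"
    using charge_received unfolding D_def by simp
  also have "\<dots> = (\<Sum>u\<in>V. \<Sum>a\<in>V. charge a u)"
    by (rule sum.mono_neutral_left) (use finV in \<open>auto simp: D_def charge_def\<close>)
  also have "\<dots> = (\<Sum>a\<in>V. \<Sum>u\<in>V. charge a u)" by (rule sum.swap)
  also have "\<dots> = (\<Sum>a\<in>V - D. \<Sum>u\<in>V. charge a u)"
    by (rule sum.mono_neutral_right) (use finV in \<open>auto simp: D_def charge_def\<close>)
  finally have "2 * card D + 8 * card (V - D) = (\<Sum>a\<in>V - D. (\<Sum>u\<in>V. charge a u) + 8)"
    by (simp add: sum.distrib)
  also have "\<dots> \<le> (\<Sum>a\<in>V - D. 3 * card (N a))"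
  proof (rule sum_mono)
    fix a assume "a \<in> V - D"
    then have "card (N a) \<ge> 3" using card_N_ge_2[of a] unfolding D_def by force
    then show "(\<Sum>u\<in>V. charge a u) + 8 \<le> 3 * card (N a)" by (rule charge_sent)
  qed
  finally have 1: "2 * card D + 8 * card (V - D) \<le> (\<Sum>a\<in>V - D. 3 * card (N a))" .
  \<comment> \<open>Added to the bound for \<open>V - D\<close>, these \<open>6 * card D\<close>
    complete the left side to \<open>8 * card V\<close>, against \<open>6 * card E\<close> on the
    right.\<close>
  have 2: "(\<Sum>a\<in>D. 3 * card (N a)) = 6 * card D" unfolding D_def by simp
  have "(\<Sum>a\<in>V. 3 * card (N a)) = (\<Sum>a\<in>V - D. 3 * card (N a)) + (\<Sum>a\<in>D. 3 * card (N a))"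
    by (rule sum.subset_diff[OF D(1) finV])
  moreover have "(\<Sum>a\<in>V. 3 * card (N a)) = 6 * card E"
    using sum_card_N by (simp flip: sum_distrib_left)
  moreover have "card V = card (V - D) + card D"
    using card_Diff_subset[OF D(2,1)] card_mono[OF finV D(1)] by linarith
  ultimately show ?thesis using 1 2 by linarith
qed

end

theorem theorem1p8:
  fixes V :: "'a set" and E :: "'a set set" and c :: "'a set \<Rightarrow> nat" and r n :: nat
  assumes "r \<ge> 6"
    and "simple_graph V E"
    and "card V = n"
    and "n \<ge> r"
    and "rainbow c E"
    and "cycle_rainbow_saturated r V E c"
  shows "real (card E) \<ge> 4 / 3 * real n"
proof -
  interpret edge_robust_saturated V E r
  proof
    show "{p (r - 1), p 0} \<in> E \<Longrightarrow> False"
      if "inj_on p {..<r}" "\<And>i. Suc i < r \<Longrightarrow> {p i, p (Suc i)} \<in> E" for p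
      using rainbow_saturated_no_cycle[OF assms(6,5,2) _ that] assms(1) by simp
    show "\<exists>p. path_avoiding r E e u v p"
      if "u \<in> V" "v \<in> V" "u \<noteq> v" "{u, v} \<notin> E" "e \<noteq> {u, v}" for u v e
      using rainbow_saturated_path[OF assms(6,5) _ that] assms(1) by simp
  qed (use assms in auto)
  show ?thesis using edge_bound assms(3) by simp
qed

end
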